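(* Let $X$ be a Banach space and let $F:\mathbb{R}\to X$ be locally Hölder-continuous and $L^1$-integrable. Suppose furthermore that for every $a\le b$ there exist $\delta>0$ and $g\in L^1(\mathbb{R})$ such that $$|s|^{-1}\sup_{t\in[a,b]}\|F(t+s)\|\le g(s)\quad\text{for all } |s|\ge\delta.$$ Then $$F(t)=\lim_{R\to\infty}\frac{1}{2\pi}\int_{-R}^{R}e^{ist}\hat F(s)\,ds\quad\text{locally uniformly in } t\in\mathbb{R}.$$
   Context: $X$ is a Banach space with complex scalars and norm $\|\cdot\|$. A function $F:\mathbb{R}\to X$ is locally Hölder-continuous if for every compact $K\subset\mathbb{R}$ there exist $\alpha_0=\alpha_0(K)\in(0,1]$ and $C=C(K)>0$ with $\|F(x)-F(y)\|\le C|x-y|^{\alpha_0}$ for all $x,y\in K$. The Fourier transform is $\hat F(k)=\int_{\mathbb{R}}e^{-iks}F(s)\,ds$, $k\in\mathbb{R}$ (Bochner integral). Locally uniformly means uniformly on every compact subset of $\mathbb{R}$, with convergence in the norm of $X$. *)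

theory Defs
  imports "HOL-Analysis.Analysis"
begin

class complex_normed_vector = real_normed_vector +
  fixes scaleC :: "complex \<Rightarrow> 'a \<Rightarrow> 'a"  (infixr \<open>*\<^sub>C\<close> 75)
  assumes scaleC_add_right: "c *\<^sub>C (x + y) = c *\<^sub>C x + c *\<^sub>C y"
    and scaleC_add_left: "(c + d) *\<^sub>C x = c *\<^sub>C x + d *\<^sub>C x"
    and scaleC_scaleC: "c *\<^sub>C d *\<^sub>C x = (c * d) *\<^sub>C x"
    and scaleC_one: "1 *\<^sub>C x = x"
    and scaleR_scaleC: "r *\<^sub>R x = complex_of_real r *\<^sub>C x"
    and norm_scaleC: "norm (c *\<^sub>C x) = cmod c * norm x"

class complex_banach = complex_normed_vector + banach

instantiation complex :: complex_banach
begin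

definition scaleC_complex :: "complex \<Rightarrow> complex \<Rightarrow> complex" where
  "scaleC_complex c x = c * x"

instance
  by standard (simp_all add: scaleC_complex_def algebra_simps norm_mult scaleR_conv_of_real)

end

text \<open>
  The Bochner integral of HOL-Analysis is restricted to separable codomains by the sort
  constraint \<open>second_countable_topology\<close>. The following three definitions repeat the library's
  \<open>has_bochner_integral\<close>, \<open>integrable\<close> and \<open>lebesgue_integral\<close> without that constraint.
  Approximability by simple functions in the \<open>L\<^sup>1\<close> sense makes the integrand essentially
  separably valued, so this is the usual Bochner integral in an arbitrary Banach space (strong
  measurability is implied, also in the non-separable case). The library hides the
  short names of \<open>simple_bochner_integrable\<close> and \<open>simple_bochner_integral\<close>; unqualified, they
  would be read as variables.
\<close>

inductive has_Bochner_integral :: "'a measure \<Rightarrow> ('a \<Rightarrow> 'b) \<Rightarrow> 'b::real_normed_vector \<Rightarrow> bool"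
  for M f x where
  "f \<in> borel_measurable M \<Longrightarrow>
    (\<And>i. Bochner_Integration.simple_bochner_integrable M (s i)) \<Longrightarrow>
    (\<lambda>i. \<integral>\<^sup>+x. norm (f x - s i x) \<partial>M) \<longlonglongrightarrow> 0 \<Longrightarrow>
    (\<lambda>i. Bochner_Integration.simple_bochner_integral M (s i)) \<longlonglongrightarrow> x \<Longrightarrow>
    has_Bochner_integral M f x"

definition Bochner_integrable :: "'a measure \<Rightarrow> ('a \<Rightarrow> 'b::real_normed_vector) \<Rightarrow> bool" where
  "Bochner_integrable M f \<longleftrightarrow> (\<exists>x. has_Bochner_integral M f x)"

definition Bochner_integral :: "'a measure \<Rightarrow> ('a \<Rightarrow> 'b::real_normed_vector) \<Rightarrow> 'b" where
  "Bochner_integral M f =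
    (if \<exists>x. has_Bochner_integral M f x then THE x. has_Bochner_integral M f x else 0)"

lemma has_Bochner_integral_eq:
  "has_Bochner_integral = (has_bochner_integral ::
     'a measure \<Rightarrow> ('a \<Rightarrow> 'b::{real_normed_vector, second_countable_topology}) \<Rightarrow> 'b \<Rightarrow> bool)"
  by (intro ext) (simp add: has_Bochner_integral.simps has_bochner_integral.simps)

lemma Bochner_integrable_eq_integrable:
  "Bochner_integrable = (integrable ::
     'a measure \<Rightarrow> ('a \<Rightarrow> 'b::{real_normed_vector, second_countable_topology}) \<Rightarrow> bool)"
  by (intro ext) (simp add: Bochner_integrable_def integrable.simps has_Bochner_integral_eq)

lemma Bochner_integral_eq_lebesgue_integral:
  "Bochner_integral = (lebesgue_integral ::
     'a measure \<Rightarrow> ('a \<Rightarrow> 'b::{real_normed_vector, second_countable_topology}) \<Rightarrow> 'b)"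
  by (intro ext) (simp add: Bochner_integral_def lebesgue_integral_def has_Bochner_integral_eq)

definition locally_Holder :: "(real \<Rightarrow> 'a::real_normed_vector) \<Rightarrow> bool" where
  "locally_Holder F \<longleftrightarrow>
    (\<forall>K. compact K \<longrightarrow>
      (\<exists>\<alpha> C. 0 < \<alpha> \<and> \<alpha> \<le> 1 \<and> 0 < C \<and>
        (\<forall>x\<in>K. \<forall>y\<in>K. norm (F x - F y) \<le> C * \<bar>x - y\<bar> powr \<alpha>)))"

definition fourier :: "(real \<Rightarrow> 'a::complex_banach) \<Rightarrow> real \<Rightarrow> 'a" where
  "fourier F k = Bochner_integral lebesgue (\<lambda>s. exp (- \<i> * of_real k * of_real s) *\<^sub>C F s)"

end

theory Submission
  imports Defs "HOL-Probability.Sinc_Integral"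
begin

text \<open>
  The partial inverse transforms of \<open>F\<close> are convolutions with the Dirichlet kernel: inserting the
  definition of the Fourier transform and exchanging the integrals gives
  \<open>(1 / 2\<pi>) \<integral>\<^bsub>[-R,R]\<^esub> e\<^bsup>ist\<^esup> F^(s) ds = \<integral> sin (R (t - u)) / (\<pi> (t - u)) F(u) du\<close>, where \<open>F^\<close> is the transform
  (lemma \<open>partial_fourier_inversion\<close>). What remains is a Dini-type theorem, lemma
  \<open>dirichlet_integral_tendsto_uniformly\<close>. Fix a compact set of points \<open>t\<close>. The part
  \<open>\<bar>t - u\<bar> \<ge> N\<close> contributes at most the \<open>L\<^sup>1\<close> norm of \<open>F\<close> divided by \<open>\<pi> N\<close>. The rest
  is folded at \<open>t\<close> into an integral over \<open>v\<close> in \<open>{0..N}\<close> of \<open>F (t + v) + F (t - v)\<close>, from which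
  \<open>2 F(t)\<close> is subtracted. The constant \<open>2 F(t)\<close> itself contributes
  \<open>(2 / \<pi>) Si (R N) F(t)\<close>, which tends to \<open>F(t)\<close>. Near \<open>v = 0\<close> the difference is
  \<open>O(v\<^sup>\<alpha>)\<close> by the Hoelder condition, so \<open>{0..\<delta>}\<close> contributes \<open>O(\<delta>\<^sup>\<alpha>)\<close> whatever
  \<open>R\<close> is. On \<open>{\<delta>..N}\<close> the integrand is \<open>sin (R v)\<close> times a function jointly continuous in
  \<open>t\<close> and \<open>v\<close>, and a Riemann--Lebesgue lemma that is uniform over compact parameter sets
  (\<open>riemann_lebesgue_uniform\<close>) makes it vanish as \<open>R\<close> grows.

  The values lie in an arbitrary Banach space, so all estimates are carried out with the
  Henstock--Kurzweil integral: it is a limit of Riemann sums, so measurability and separability of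
  the values do not enter. The bridge is
  \<open>Bochner_integral_continuous\<close>: for a continuous function whose norm is integrable both integrals
  agree. Integration against \<open>F\<close> over the whole line is then the limit of integrals over
  bounded intervals, on which Fubini for continuous functions suffices.
\<close>

section \<open>Bochner integrals of continuous functions\<close>

text \<open>In a non-separable space the difference of two Borel functions need not be Borel. A simple
  function takes finitely many values, so here the difference is pieced together from
  translates of \<open>f\<close> by constants.\<close>

lemma borel_measurable_norm_diff_simple_function:
  fixes f s :: "'b \<Rightarrow> 'a::real_normed_vector"
  assumes f: "f \<in> borel_measurable M" and s: "simple_function M s"
  shows "(\<lambda>x. norm (f x - s x)) \<in> borel_measurable M"
proof -
  have "(\<lambda>x. norm (f x - y)) \<in> borel_measurable M" for y
    by (intro measurable_compose[OF f] borel_measurable_continuous_onI continuous_intros)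
  moreover have "s \<in> measurable M (count_space (s ` space M))"
    using s by (auto simp: simple_function_def measurable_count_space_eq2)
  moreover have "countable (s ` space M)"
    using s by (simp add: simple_function_def countable_finite)
  ultimately show ?thesis
    by (rule measurable_compose_countable'[where f = "\<lambda>y x. norm (f x - y)" and g = s])
qed

lemma norm_simple_bochner_integral_diff_le:
  fixes f :: "'b \<Rightarrow> 'a::real_normed_vector"
  assumes f: "f \<in> borel_measurable M"
    and s: "Bochner_Integration.simple_bochner_integrable M s"
    and t: "Bochner_Integration.simple_bochner_integrable M t"
  shows "ennreal (norm (Bochner_Integration.simple_bochner_integral M s
             - Bochner_Integration.simple_bochner_integral M t))
    \<le> (\<integral>\<^sup>+x. norm (f x - s x) \<partial>M) + (\<integral>\<^sup>+x. norm (f x - t x) \<partial>M)"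
proof -
  have "simple_function M s" "simple_function M t"
    using s t by (auto elim: Bochner_Integration.simple_bochner_integrable.cases)
  note [measurable] = this[THEN borel_measurable_norm_diff_simple_function[OF f]]
  have st: "Bochner_Integration.simple_bochner_integrable M (\<lambda>x. s x - t x)"
    "Bochner_Integration.simple_bochner_integrable M (\<lambda>x. norm (s x - t x))"
    using simple_bochner_integrable_compose2[OF _ s t, of "(-)"]
      simple_bochner_integrable_compose2[OF _ s t, of "\<lambda>x y. norm (x - y)"] by simp_all
  have "ennreal (norm (Bochner_Integration.simple_bochner_integral M s
             - Bochner_Integration.simple_bochner_integral M t))
      \<le> Bochner_Integration.simple_bochner_integral M (\<lambda>x. norm (s x - t x))"
    using simple_bochner_integral_norm_bound[OF st(1)] simple_bochner_integral_diff[OF s t]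
    by (simp add: ennreal_leI)
  also have "\<dots> = (\<integral>\<^sup>+x. norm (s x - t x) \<partial>M)"
    using st(2) by (rule simple_bochner_integral_eq_nn_integral) simp
  also have "\<dots> \<le> (\<integral>\<^sup>+x. ennreal (norm (f x - s x)) + ennreal (norm (f x - t x)) \<partial>M)"
  proof (rule nn_integral_mono)
    fix x
    have "norm (s x - t x) \<le> norm (f x - s x) + norm (f x - t x)"
      using norm_triangle_ineq4[of "f x - t x" "f x - s x"] by (simp add: add.commute)
    then show "ennreal (norm (s x - t x)) \<le> ennreal (norm (f x - s x)) + ennreal (norm (f x - t x))"
      by (simp add: ennreal_leI flip: ennreal_plus)
  qed
  also have "\<dots> = (\<integral>\<^sup>+x. norm (f x - s x) \<partial>M) + (\<integral>\<^sup>+x. norm (f x - t x) \<partial>M)"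
    by (rule nn_integral_add) auto
  finally show ?thesis .
qed

text \<open>Two sequences of simple functions that approximate \<open>f\<close> in \<open>L\<^sup>1\<close> are close to each other
  in \<open>L\<^sup>1\<close>, hence their integrals have the same limit.\<close>

lemma has_Bochner_integral_unique:
  assumes "has_Bochner_integral M f x" "has_Bochner_integral M f y"
  shows "x = y"
  using assms
proof (elim has_Bochner_integral.cases)
  fix s t
  assume f: "f \<in> borel_measurable M"
    and s: "\<And>i. Bochner_Integration.simple_bochner_integrable M (s i)"
    and t: "\<And>i. Bochner_Integration.simple_bochner_integrable M (t i)"
    and lim: "(\<lambda>i. \<integral>\<^sup>+x. norm (f x - s i x) \<partial>M) \<longlonglongrightarrow> 0"
      "(\<lambda>i. \<integral>\<^sup>+x. norm (f x - t i x) \<partial>M) \<longlonglongrightarrow> 0"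
      "(\<lambda>i. Bochner_Integration.simple_bochner_integral M (s i)) \<longlonglongrightarrow> x"
      "(\<lambda>i. Bochner_Integration.simple_bochner_integral M (t i)) \<longlonglongrightarrow> y"
  have "(\<lambda>i. ennreal (norm (Bochner_Integration.simple_bochner_integral M (s i)
      - Bochner_Integration.simple_bochner_integral M (t i)))) \<longlonglongrightarrow> 0"
    by (rule tendsto_sandwich[OF _ _ tendsto_const])
      (use tendsto_add[OF lim(1,2)] norm_simple_bochner_integral_diff_le[OF f s t] in auto)
  then have "(\<lambda>i. norm (Bochner_Integration.simple_bochner_integral M (s i)
      - Bochner_Integration.simple_bochner_integral M (t i))) \<longlonglongrightarrow> 0"
    by (simp add: ennreal_0[symmetric] del: ennreal_0)
  moreover have "(\<lambda>i. norm (Bochner_Integration.simple_bochner_integral M (s i)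
      - Bochner_Integration.simple_bochner_integral M (t i))) \<longlonglongrightarrow> norm (x - y)"
    by (intro tendsto_intros lim)
  ultimately have "norm (x - y) = 0"
    by (rule LIMSEQ_unique[symmetric])
  then show "x = y" by simp
qed

lemma Bochner_integral_eqI:
  "has_Bochner_integral M f x \<Longrightarrow> Bochner_integral M f = x"
  unfolding Bochner_integral_def by (auto intro: has_Bochner_integral_unique)

lemma integrable_norm_if_Bochner_integrable:
  fixes f :: "'b \<Rightarrow> 'a::real_normed_vector"
  assumes "Bochner_integrable M f"
  shows "integrable M (\<lambda>x. norm (f x))"
proof -
  obtain s where f: "f \<in> borel_measurable M"
    and s: "\<And>i::nat. Bochner_Integration.simple_bochner_integrable M (s i)"
    and lim: "(\<lambda>i. \<integral>\<^sup>+x. norm (f x - s i x) \<partial>M) \<longlonglongrightarrow> 0"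
    using assms unfolding Bochner_integrable_def by (auto elim!: has_Bochner_integral.cases)
  have "\<forall>\<^sub>F i in sequentially. (\<integral>\<^sup>+x. norm (f x - s i x) \<partial>M) < 1"
    using lim by (rule order_tendstoD) simp
  then obtain i where i: "(\<integral>\<^sup>+x. norm (f x - s i x) \<partial>M) < 1"
    using eventually_happens by fastforce
  have "simple_function M (s i)"
    using s by (auto elim: Bochner_Integration.simple_bochner_integrable.cases)
  note 1 = borel_measurable_norm_diff_simple_function[OF f this]
  have 2: "integrable M (\<lambda>x. norm (f x - s i x))"
    using 1 i by (intro integrableI_bounded) (auto intro: less_trans)
  have "Bochner_Integration.simple_bochner_integrable M (\<lambda>x. norm (s i x))"
    using simple_bochner_integrable_compose2[OF _ s s, of "\<lambda>x y. norm x"] by simp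
  then have 3: "integrable M (\<lambda>x. norm (s i x))"
    by (auto intro: integrable.intros has_bochner_integral_simple_bochner_integrable)
  show ?thesis
  proof (rule Bochner_Integration.integrable_bound[OF Bochner_Integration.integrable_add[OF 2 3]])
    show "(\<lambda>x. norm (f x)) \<in> borel_measurable M"
      by (intro measurable_compose[OF f] borel_measurable_continuous_onI continuous_intros)
    show "AE x in M. norm (norm (f x)) \<le> norm (norm (f x - s i x) + norm (s i x))"
      using norm_triangle_sub by (auto simp: add.commute)
  qed
qed

text \<open>On simple functions the Bochner and the Henstock--Kurzweil integral agree; this is where the
  comparison of the two integrals starts. The level set of \<open>0\<close> may have infinite measure, but it
  carries the value \<open>0\<close>.\<close>

lemma has_integral_simple_bochner_integral:
  fixes s :: "'n::euclidean_space \<Rightarrow> 'a::real_normed_vector"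
  assumes S: "S \<in> sets lebesgue"
    and s: "Bochner_Integration.simple_bochner_integrable (lebesgue_on S) s"
  shows "(s has_integral Bochner_Integration.simple_bochner_integral (lebesgue_on S) s) S"
proof -
  let ?A = "\<lambda>y. {x \<in> S. s x = y}"
  have sf: "simple_function (lebesgue_on S) s"
    and supp: "emeasure (lebesgue_on S) {x \<in> S. s x \<noteq> 0} \<noteq> \<infinity>"
    using s by (auto elim: Bochner_Integration.simple_bochner_integrable.cases)
  have fin: "finite (s ` S)"
    using sf by (simp add: simple_function_def)
  have Asets: "?A y \<in> sets (lebesgue_on S)" for y
  proof -
    have "s -` {y} \<inter> S \<in> sets (lebesgue_on S)"
      using simple_functionD(2)[OF sf, of "{y}"] by simp
    moreover have "s -` {y} \<inter> S = ?A y" by auto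
    ultimately show ?thesis by simp
  qed
  have part: "((\<lambda>x. indicator (?A y) x *\<^sub>R y) has_integral
      measure (lebesgue_on S) (?A y) *\<^sub>R y) S" for y
  proof (cases "y = 0")
    case False
    have supp_sets: "{x \<in> S. s x \<noteq> 0} \<in> sets (lebesgue_on S)"
    proof -
      have "{x \<in> S. s x \<noteq> 0} = space (lebesgue_on S) - ?A 0" by auto
      then show ?thesis using Asets[of 0] by (metis sets.compl_sets)
    qed
    have "emeasure (lebesgue_on S) (?A y) \<le> emeasure (lebesgue_on S) {x \<in> S. s x \<noteq> 0}"
      using False supp_sets by (intro emeasure_mono) auto
    then have "emeasure lebesgue (?A y) \<noteq> \<infinity>"
      using supp S by (subst (asm) (1) emeasure_restrict_space) (auto simp: top_unique)
    moreover have "?A y \<in> sets lebesgue"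
      using Asets[of y] S by (auto simp: sets_restrict_space_iff)
    ultimately have "?A y \<in> lmeasurable"
      by (intro fmeasurableI) (auto simp: less_top)
    then have "(indicator (?A y) has_integral measure lebesgue (?A y)) UNIV"
      by (simp add: lmeasurable_iff_has_integral)
    moreover have "indicator (?A y) = (\<lambda>x. if x \<in> S then indicator (?A y) x else (0::real))"
      by (auto simp: indicator_def fun_eq_iff)
    ultimately have "(indicator (?A y) has_integral measure lebesgue (?A y)) S"
      by (subst has_integral_restrict_UNIV[symmetric]) simp
    then have "((\<lambda>x. indicator (?A y) x *\<^sub>R y) has_integral measure lebesgue (?A y) *\<^sub>R y) S"
      by (rule has_integral_scaleR_left)
    then show ?thesis
      using S by (subst measure_restrict_space) auto
  qed simp
  have "((\<lambda>x. \<Sum>y\<in>s ` S. indicator (?A y) x *\<^sub>R y) has_integral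
      (\<Sum>y\<in>s ` S. measure (lebesgue_on S) (?A y) *\<^sub>R y)) S"
    using fin part by (intro has_integral_sum)
  moreover have "(\<Sum>y\<in>s ` S. indicator (?A y) x *\<^sub>R y) = s x" if "x \<in> S" for x
  proof -
    have "(\<Sum>y\<in>s ` S. indicator (?A y) x *\<^sub>R y) = (\<Sum>y\<in>s ` S. if y = s x then y else 0)"
      using that by (intro sum.cong) (auto simp: indicator_def)
    also have "\<dots> = s x" using fin that by simp
    finally show ?thesis .
  qed
  ultimately show ?thesis
    unfolding simple_bochner_integral_def by (subst has_integral_cong) auto
qed

lemma borel_measurable_lebesgue_on_if_continuous:
  fixes f :: "'n::euclidean_space \<Rightarrow> 'a::topological_space"
  assumes "continuous_on UNIV f"
  shows "f \<in> borel_measurable (lebesgue_on S)"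
  by (intro measurable_restrict_space1 measurable_completion)
    (use borel_measurable_continuous_onI[OF assms] in simp)

text \<open>Rounding the argument of \<open>f\<close> down to a fine grid gives a step function that is uniformly close to
  \<open>f\<close> on a bounded interval, by uniform continuity there; outside a large interval the norm of
  \<open>f\<close> has small integral and \<open>f\<close> is replaced by \<open>0\<close>.\<close>

lemma L1_step_approximation:
  fixes f :: "real \<Rightarrow> 'a::real_normed_vector"
  assumes cont: "continuous_on UNIV f" and S: "S \<in> sets lebesgue"
    and int: "integrable (lebesgue_on S) (\<lambda>x. norm (f x))" and e: "0 < e"
  obtains s where "Bochner_Integration.simple_bochner_integrable (lebesgue_on S) s"
    "(\<integral>\<^sup>+x. norm (f x - s x) \<partial>lebesgue_on S) \<le> ennreal e"
proof -
  let ?M = "lebesgue_on S"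
  have [measurable]: "(\<lambda>x. x) \<in> borel_measurable ?M" "(\<lambda>x. norm (f x)) \<in> borel_measurable ?M"
    using int by (auto intro: borel_measurable_lebesgue_on_if_continuous)
  have "(\<lambda>n::nat. \<integral>x. indicator {x. real n < \<bar>x\<bar>} x *\<^sub>R norm (f x) \<partial>?M) \<longlonglongrightarrow> (\<integral>x. 0 \<partial>?M)"
  proof (rule integral_dominated_convergence[OF _ _ int])
    show "(\<lambda>x. indicator {x. real n < \<bar>x\<bar>} x *\<^sub>R norm (f x)) \<in> borel_measurable ?M" for n
      by measurable
    show "AE x in ?M. (\<lambda>n. indicator {x. real n < \<bar>x\<bar>} x *\<^sub>R norm (f x)) \<longlonglongrightarrow> 0"
    proof (rule AE_I2)
      fix x
      obtain m :: nat where "\<bar>x\<bar> \<le> real m" using real_arch_simple by blast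
      then have "indicator {x. real n < \<bar>x\<bar>} x *\<^sub>R norm (f x) = 0" if "m \<le> n" for n
        using that by (simp add: indicator_def)
      then have "\<forall>\<^sub>F n in sequentially. indicator {x. real n < \<bar>x\<bar>} x *\<^sub>R norm (f x) = 0"
        by (rule eventually_sequentiallyI)
      then show "(\<lambda>n. indicator {x. real n < \<bar>x\<bar>} x *\<^sub>R norm (f x)) \<longlonglongrightarrow> 0"
        by (rule tendsto_eventually)
    qed
  qed (auto simp: indicator_def)
  then have "\<forall>\<^sub>F n in sequentially. (\<integral>x. indicator {x. real n < \<bar>x\<bar>} x *\<^sub>R norm (f x) \<partial>?M) < e / 2"
    using e by (intro order_tendstoD) auto
  then obtain n :: nat where n: "(\<integral>x. indicator {x. real n < \<bar>x\<bar>} x *\<^sub>R norm (f x) \<partial>?M) < e / 2"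
    using eventually_happens by fastforce
  \<comment> \<open>With this uniform error the interval of length \<open>2 n\<close> contributes at most \<open>e / 2\<close>.\<close>
  define \<eta> where "\<eta> = e / (4 * real (Suc n))"
  have \<eta>: "0 < \<eta>" using e by (simp add: \<eta>_def)
  \<comment> \<open>The interval is enlarged by \<open>1\<close> because rounding down may leave \<open>{- n..n}\<close>.\<close>
  have "uniformly_continuous_on {- real n - 1..real n + 1} f"
    by (intro compact_uniformly_continuous continuous_on_subset[OF cont]) auto
  then obtain d where d: "0 < d" "\<And>x y. x \<in> {- real n - 1..real n + 1} \<Longrightarrow>
      y \<in> {- real n - 1..real n + 1} \<Longrightarrow> dist y x < d \<Longrightarrow> dist (f y) (f x) < \<eta>"
    using \<eta> unfolding uniformly_continuous_on_def by metis
  define m where "m = max 1 (2 / d)"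
  have m: "1 \<le> m" "1 / m < d"
    using d(1) by (auto simp: m_def field_simps max_def)
  \<comment> \<open>The indicator inside the floor keeps the range of \<open>j\<close> finite.\<close>
  define j where "j = (\<lambda>x. \<lfloor>m * (indicator {- real n..real n} x * x)\<rfloor>)"
  define s where "s = (\<lambda>x. if \<bar>x\<bar> \<le> real n then f (real_of_int (j x) / m) else 0)"
  have near: "norm (f x - s x) \<le> \<eta>" if "\<bar>x\<bar> \<le> real n" for x
  proof -
    have jx: "real_of_int (j x) \<le> m * x" "m * x < real_of_int (j x) + 1"
      using that by (auto simp: j_def indicator_def abs_le_iff)
    then have "real_of_int (j x) / m \<le> x" "x < (real_of_int (j x) + 1) / m"
      using m(1) by (simp_all add: pos_less_divide_eq pos_divide_le_eq mult.commute)
    then have "real_of_int (j x) / m \<le> x" "x - 1 / m < real_of_int (j x) / m"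
      by (simp_all add: add_divide_distrib)
    moreover have "1 / m \<le> 1" using m(1) by simp
    ultimately have "dist (f x) (f (real_of_int (j x) / m)) < \<eta>"
      using that m(2) by (intro d(2)) (auto simp: dist_real_def)
    then show ?thesis using that by (simp add: s_def dist_norm)
  qed
  have "simple_function ?M j"
  proof (subst simple_function_def, intro conjI ballI)
    have "j ` UNIV \<subseteq> {\<lfloor>- (m * real n)\<rfloor>..\<lfloor>m * real n\<rfloor>}"
    proof (rule image_subsetI)
      fix x
      let ?y = "indicator {- real n..real n} x * x"
      have "- real n \<le> ?y" "?y \<le> real n" by (auto simp: indicator_def)
      then have "m * - real n \<le> m * ?y" "m * ?y \<le> m * real n"
        using m(1) mult_left_mono[of "- real n" ?y m] mult_left_mono[of ?y "real n" m] by simp_all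
      then show "j x \<in> {\<lfloor>- (m * real n)\<rfloor>..\<lfloor>m * real n\<rfloor>}"
        by (simp add: j_def floor_mono)
    qed
    then show "finite (j ` space ?M)"
      by (rule finite_subset[OF subset_trans[OF image_mono[OF subset_UNIV]]]) simp
    show "j -` {k} \<inter> space ?M \<in> sets ?M" for k
    proof -
      have "{x \<in> space ?M. j x = k} \<in> sets ?M"
        unfolding j_def by measurable
      moreover have "j -` {k} \<inter> space ?M = {x \<in> space ?M. j x = k}" by auto
      ultimately show ?thesis by simp
    qed
  qed
  then have "simple_function ?M (\<lambda>x. f (real_of_int (j x) / m))"
    by (rule simple_function_compose1)
  moreover have "{x \<in> space ?M. \<bar>x\<bar> \<le> real n} \<in> sets ?M" by measurable
  ultimately have sf: "simple_function ?M s"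
    unfolding s_def by (intro simple_function_If) auto
  have box_sets: "{- real n..real n} \<inter> S \<in> sets ?M"
    using S by (auto simp: sets_restrict_space_iff intro: sets.Int)
  have box: "emeasure ?M ({- real n..real n} \<inter> S) \<le> ennreal (2 * real n)"
  proof -
    have "emeasure ?M ({- real n..real n} \<inter> S) \<le> emeasure lebesgue {- real n..real n}"
      using S emeasure_mono[of "{- real n..real n} \<inter> S" "{- real n..real n}" lebesgue]
      by (simp add: emeasure_restrict_space)
    then show ?thesis by simp
  qed
  have "emeasure ?M {x \<in> space ?M. s x \<noteq> 0} \<le> emeasure ?M ({- real n..real n} \<inter> S)"
    using box_sets by (intro emeasure_mono subsetI) (auto simp: s_def split: if_splits)
  also note box
  finally have "Bochner_Integration.simple_bochner_integrable ?M s"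
    using sf by (intro Bochner_Integration.simple_bochner_integrable.intros) (auto simp: top_unique)
  moreover have "(\<integral>\<^sup>+x. norm (f x - s x) \<partial>?M) \<le> ennreal e"
  proof -
    have ind: "integrable ?M (\<lambda>x. indicator {x. real n < \<bar>x\<bar>} x *\<^sub>R norm (f x))"
      by (rule Bochner_Integration.integrable_bound[OF int]) (use int in \<open>auto simp: indicator_def\<close>)
    have "(\<integral>\<^sup>+x. norm (f x - s x) \<partial>?M) \<le> (\<integral>\<^sup>+x. ennreal \<eta> * indicator ({- real n..real n} \<inter> S) x
        + ennreal (indicator {x. real n < \<bar>x\<bar>} x *\<^sub>R norm (f x)) \<partial>?M)"
    proof (rule nn_integral_mono)
      fix x assume "x \<in> space ?M"
      then show "ennreal (norm (f x - s x)) \<le> ennreal \<eta> * indicator ({- real n..real n} \<inter> S) x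
        + ennreal (indicator {x. real n < \<bar>x\<bar>} x *\<^sub>R norm (f x))"
        using near[of x] by (cases "\<bar>x\<bar> \<le> real n") (auto simp: indicator_def s_def ennreal_leI)
    qed
    also have "\<dots> = ennreal \<eta> * emeasure ?M ({- real n..real n} \<inter> S)
        + ennreal (\<integral>x. indicator {x. real n < \<bar>x\<bar>} x *\<^sub>R norm (f x) \<partial>?M)"
    proof (subst nn_integral_add)
      show "(\<lambda>x. ennreal \<eta> * indicator ({- real n..real n} \<inter> S) x) \<in> borel_measurable ?M"
        using box_sets by simp
      show "(\<lambda>x. ennreal (indicator {x. real n < \<bar>x\<bar>} x *\<^sub>R norm (f x))) \<in> borel_measurable ?M"
        using borel_measurable_integrable[OF ind] by simp
      show "(\<integral>\<^sup>+x. ennreal \<eta> * indicator ({- real n..real n} \<inter> S) x \<partial>?M)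
          + (\<integral>\<^sup>+x. ennreal (indicator {x. real n < \<bar>x\<bar>} x *\<^sub>R norm (f x)) \<partial>?M)
        = ennreal \<eta> * emeasure ?M ({- real n..real n} \<inter> S)
          + ennreal (\<integral>x. indicator {x. real n < \<bar>x\<bar>} x *\<^sub>R norm (f x) \<partial>?M)"
        by (subst nn_integral_cmult_indicator[OF box_sets], subst nn_integral_eq_integral[OF ind])
          (simp_all add: indicator_def)
    qed
    also have "\<dots> \<le> ennreal \<eta> * ennreal (2 * real n) + ennreal (e / 2)"
      using n by (intro add_mono mult_left_mono box ennreal_leI) auto
    also have "\<dots> = ennreal (\<eta> * (2 * real n) + e / 2)"
      using \<eta> e by (simp flip: ennreal_mult ennreal_plus)
    also have "\<dots> \<le> ennreal e"
      using e by (intro ennreal_leI) (simp add: \<eta>_def field_simps)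
    finally show ?thesis .
  qed
  ultimately show ?thesis by (rule that)
qed

text \<open>The step functions above have the same Bochner and Henstock--Kurzweil integrals, and both
  integrals are continuous with respect to the \<open>L\<^sup>1\<close> distance.\<close>

lemma has_Bochner_integral_continuous:
  fixes f :: "real \<Rightarrow> 'a::banach"
  assumes cont: "continuous_on UNIV f" and S: "S \<in> sets lebesgue"
    and f: "f integrable_on S" and nf: "(\<lambda>x. norm (f x)) integrable_on S"
  shows "has_Bochner_integral (lebesgue_on S) f (integral S f)"
proof -
  let ?M = "lebesgue_on S"
  have int: "integrable ?M (\<lambda>x. norm (f x))"
    using nonnegative_absolutely_integrable_1[OF nf] S by (simp add: integrable_restrict_space set_integrable_def)
  have fm: "f \<in> borel_measurable ?M"
    using cont by (rule borel_measurable_lebesgue_on_if_continuous)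
  have "\<forall>i::nat. \<exists>s. Bochner_Integration.simple_bochner_integrable ?M s \<and>
      (\<integral>\<^sup>+x. norm (f x - s x) \<partial>?M) \<le> ennreal (inverse (real (Suc i)))"
  proof
    fix i :: nat
    have "0 < inverse (real (Suc i))" by simp
    from L1_step_approximation[OF cont S int this] show "\<exists>s. Bochner_Integration.simple_bochner_integrable ?M s \<and>
      (\<integral>\<^sup>+x. norm (f x - s x) \<partial>?M) \<le> ennreal (inverse (real (Suc i)))" by blast
  qed
  then obtain s where s: "\<And>i. Bochner_Integration.simple_bochner_integrable ?M (s i)"
    and close: "\<And>i::nat. (\<integral>\<^sup>+x. norm (f x - s i x) \<partial>?M) \<le> ennreal (inverse (real (Suc i)))"
    by metis
  have inv0: "(\<lambda>i. inverse (real (Suc i))) \<longlonglongrightarrow> 0"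
    by (rule LIMSEQ_inverse_real_of_nat)
  have "norm (integral S f - Bochner_Integration.simple_bochner_integral ?M (s i))
      \<le> inverse (real (Suc i))" for i
  proof -
    have "simple_function ?M (s i)"
      using s by (auto elim: Bochner_Integration.simple_bochner_integrable.cases)
    note m = borel_measurable_norm_diff_simple_function[OF fm this]
    have "(\<integral>\<^sup>+x. norm (f x - s i x) \<partial>?M) < \<infinity>"
      using close[of i] by (rule order_le_less_trans) simp
    then have I: "integrable ?M (\<lambda>x. norm (f x - s i x))"
      using m by (intro integrableI_bounded) auto
    have "ennreal (\<integral>x. norm (f x - s i x) \<partial>?M) = (\<integral>\<^sup>+x. norm (f x - s i x) \<partial>?M)"
      using I by (rule nn_integral_eq_integral[symmetric]) simp
    also note close[of i]
    finally have le: "(\<integral>x. norm (f x - s i x) \<partial>?M) \<le> inverse (real (Suc i))"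
      by (subst (asm) ennreal_le_iff) simp_all
    note si = has_integral_simple_bochner_integral[OF S s[of i]]
    have "norm (integral S f - Bochner_Integration.simple_bochner_integral ?M (s i))
        = norm (integral S (\<lambda>x. f x - s i x))"
      using f si by (simp add: Henstock_Kurzweil_Integration.integral_diff has_integral_iff)
    also have "\<dots> \<le> integral S (\<lambda>x. norm (f x - s i x))"
      using f si I S
      by (intro Henstock_Kurzweil_Integration.integral_norm_bound_integral)
        (auto simp: has_integral_iff intro: Henstock_Kurzweil_Integration.integrable_diff integrable_on_lebesgue_on)
    also have "\<dots> = (\<integral>x. norm (f x - s i x) \<partial>?M)"
      using lebesgue_integral_eq_integral[OF I S] by simp
    finally show ?thesis using le by simp
  qed
  then have "(\<lambda>i. integral S f - Bochner_Integration.simple_bochner_integral ?M (s i)) \<longlonglongrightarrow> 0"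
    by (intro Lim_null_comparison[OF _ inv0]) auto
  then have lim: "(\<lambda>i. Bochner_Integration.simple_bochner_integral ?M (s i)) \<longlonglongrightarrow> integral S f"
    using tendsto_diff[OF tendsto_const[of "integral S f"], of _ 0] by force
  have "(\<lambda>i. ennreal (inverse (real (Suc i)))) \<longlonglongrightarrow> ennreal 0"
    using inv0 by (rule tendsto_ennrealI)
  then have inv0': "(\<lambda>i. ennreal (inverse (real (Suc i)))) \<longlonglongrightarrow> 0" by simp
  have "(\<lambda>i. \<integral>\<^sup>+x. norm (f x - s i x) \<partial>?M) \<longlonglongrightarrow> 0"
  proof (rule tendsto_sandwich[OF _ _ tendsto_const inv0'])
    show "\<forall>\<^sub>F i in sequentially. (\<integral>\<^sup>+x. norm (f x - s i x) \<partial>?M) \<le> ennreal (inverse (real (Suc i)))"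
      using close by (rule always_eventually[OF allI])
  qed simp
  from has_Bochner_integral.intros[OF fm s this lim] show ?thesis .
qed

lemma Bochner_integral_continuous:
  fixes f :: "real \<Rightarrow> 'a::banach"
  assumes "continuous_on UNIV f" "S \<in> sets lebesgue"
    and "f integrable_on S" "(\<lambda>x. norm (f x)) integrable_on S"
  shows "Bochner_integral (lebesgue_on S) f = integral S f"
  using assms by (intro Bochner_integral_eqI has_Bochner_integral_continuous)

section \<open>Multiplication by complex scalars\<close>

lemma bounded_bilinear_scaleC:
  "bounded_bilinear (scaleC :: complex \<Rightarrow> 'a \<Rightarrow> 'a::complex_normed_vector)"
proof
  show "\<exists>K. \<forall>c (x::'a). norm (c *\<^sub>C x) \<le> norm c * norm x * K"
    by (intro exI[of _ 1]) (simp add: norm_scaleC)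
qed (simp_all add: scaleC_add_left scaleC_add_right scaleR_scaleC scaleC_scaleC
      scaleC_complex_def mult.commute)

lemmas continuous_on_scaleC [continuous_intros] =
  bounded_bilinear.continuous_on[OF bounded_bilinear_scaleC]

lemma norm_cis_scaleC [simp]: "norm (cis a *\<^sub>C x) = norm (x :: 'a::complex_normed_vector)"
  by (simp add: norm_scaleC)

section \<open>The Dirichlet kernel\<close>

text \<open>This is \<open>1 / (2\<pi>)\<close> times the integral of \<open>cis (s v)\<close> over \<open>s\<close> in \<open>{-R..R}\<close>. The value at \<open>v = 0\<close> is
  the continuous extension.\<close>

definition dirichlet_kernel :: "real \<Rightarrow> real \<Rightarrow> real" where
  "dirichlet_kernel R v = (if v = 0 then R else sin (R * v) / v) / pi"

lemma dirichlet_kernel_sinc: "dirichlet_kernel R v = R / pi * sinc (R * v)"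
  by (auto simp: dirichlet_kernel_def)

lemma dirichlet_kernel_minus [simp]: "dirichlet_kernel R (- v) = dirichlet_kernel R v"
  by (simp add: dirichlet_kernel_def)

lemma continuous_on_dirichlet_kernel [continuous_intros]:
  assumes "continuous_on S f"
  shows "continuous_on S (\<lambda>x. dirichlet_kernel R (f x))"
proof -
  have "continuous_on UNIV sinc"
    using isCont_sinc by (intro continuous_at_imp_continuous_on) blast
  then have "continuous_on S (\<lambda>x. sinc (R * f x))"
    by (rule continuous_on_compose2) (auto intro!: continuous_intros assms)
  then show ?thesis
    unfolding dirichlet_kernel_sinc by (rule continuous_on_mult[OF continuous_on_const])
qed

lemma abs_dirichlet_kernel_le: "\<bar>dirichlet_kernel R v\<bar> \<le> \<bar>R\<bar> / pi"
proof (cases "v = 0")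
  case False
  have "\<bar>sin (R * v)\<bar> \<le> \<bar>R\<bar> * \<bar>v\<bar>"
    using abs_sin_x_le_abs_x[of "R * v"] by (simp add: abs_mult)
  then show ?thesis
    using False by (simp add: dirichlet_kernel_def abs_divide abs_mult divide_right_mono pos_divide_le_eq)
qed (simp add: dirichlet_kernel_def)

lemma abs_dirichlet_kernel_le_inverse:
  assumes "v \<noteq> 0"
  shows "\<bar>dirichlet_kernel R v\<bar> \<le> 1 / (pi * \<bar>v\<bar>)"
  using assms abs_sin_le_one[of "R * v"]
  by (simp add: dirichlet_kernel_def abs_divide abs_mult divide_right_mono mult.commute)

lemma has_integral_cis_dirichlet_kernel:
  assumes "0 \<le> R"
  shows "((\<lambda>s. cis (s * v)) has_integral of_real (2 * pi * dirichlet_kernel R v)) {-R..R}"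
proof (cases "v = 0")
  case True
  then show ?thesis
    using has_integral_const_real[of "1::complex" "-R" R] assms
    by (simp add: dirichlet_kernel_def scaleR_conv_of_real)
next
  case False
  have "((\<lambda>s. cis (s * v)) has_integral
      cis (R * v) / (\<i> * of_real v) - cis (- R * v) / (\<i> * of_real v)) {-R..R}"
  proof (rule fundamental_theorem_of_calculus)
    show "-R \<le> R" using assms by simp
    fix s assume "s \<in> {-R..R}"
    have "((\<lambda>z. exp (\<i> * (z * of_real v)) / (\<i> * of_real v)) has_field_derivative
        exp (\<i> * (of_real s * of_real v))) (at (of_real s))"
      using False by (auto intro!: derivative_eq_intros simp: ac_simps)
    then have "((\<lambda>z. exp (\<i> * (of_real z * of_real v)) / (\<i> * of_real v)) has_vector_derivative
        exp (\<i> * (of_real s * of_real v))) (at s within {-R..R})"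
      by (rule has_vector_derivative_real_field)
    then show "((\<lambda>s. cis (s * v) / (\<i> * of_real v)) has_vector_derivative cis (s * v)) (at s within {-R..R})"
      by (simp add: cis_conv_exp)
  qed
  moreover have "cis (R * v) / (\<i> * of_real v) - cis (- R * v) / (\<i> * of_real v)
      = of_real (2 * pi * dirichlet_kernel R v)"
  proof -
    have "cis (R * v) - cis (- R * v) = 2 * \<i> * of_real (sin (R * v))"
      by (simp add: complex_eq_iff)
    then show ?thesis
      using False by (simp add: dirichlet_kernel_def diff_divide_distrib[symmetric])
  qed
  ultimately show ?thesis by simp
qed

lemma has_integral_dirichlet_kernel:
  assumes "0 \<le> N"
  shows "(dirichlet_kernel R has_integral Si (R * N) / pi) {0..N}"
proof -
  have "(dirichlet_kernel R has_integral Si (R * N) / pi - Si (R * 0) / pi) {0..N}"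
  proof (rule fundamental_theorem_of_calculus)
    fix v
    have "((\<lambda>v. Si (R * v)) has_real_derivative sinc (R * v) * R) (at v within {0..N})"
      by (rule DERIV_chain2[OF DERIV_Si]) (auto intro!: derivative_eq_intros)
    then have "((\<lambda>v. Si (R * v) / pi) has_real_derivative sinc (R * v) * R / pi) (at v within {0..N})"
      by (rule DERIV_cdivide)
    then show "((\<lambda>v. Si (R * v) / pi) has_vector_derivative dirichlet_kernel R v) (at v within {0..N})"
      by (simp add: dirichlet_kernel_sinc has_real_derivative_iff_has_vector_derivative mult.commute)
  qed (use assms in auto)
  moreover have "Si 0 = 0" using Si_neg[of 0] by simp
  ultimately show ?thesis by simp
qed

section \<open>Integrals over the line as limits over bounded intervals\<close>

lemma integrable_on_UNIV_if_dominated: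
  fixes f :: "real \<Rightarrow> 'a::banach"
  assumes "continuous_on UNIV f" "\<And>x. norm (f x) \<le> g x" "g integrable_on UNIV"
  shows "f integrable_on UNIV"
proof (rule integrable_on_all_intervals_integrable_bound[OF _ assms(2,3)])
  show "(\<lambda>x. if x \<in> UNIV then f x else 0) integrable_on cbox a b" for a b
    using integrable_continuous[OF continuous_on_subset[OF assms(1)], of a b] by simp
qed

text \<open>Domination is required only off the interval, so that \<open>g\<close> may be a multiple of \<open>norm \<circ> F\<close> that
  bounds a kernel times \<open>F\<close> only far away from the kernel's singularity.\<close>

lemma norm_integral_tail_le:
  fixes f :: "real \<Rightarrow> 'a::banach"
  assumes "f integrable_on UNIV" "f integrable_on {a..b}"
    and "g integrable_on UNIV" "g integrable_on {a..b}"
    and "\<And>x. x \<notin> {a..b} \<Longrightarrow> norm (f x) \<le> g x"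
  shows "norm (integral UNIV f - integral {a..b} f) \<le> integral UNIV g - integral {a..b} g"
proof -
  have "(f has_integral integral UNIV f - integral {a..b} f) (UNIV - {a..b})"
    "(g has_integral integral UNIV g - integral {a..b} g) (UNIV - {a..b})"
    using assms by (auto intro!: has_integral_setdiff integrable_integral)
  with assms(5) Henstock_Kurzweil_Integration.integral_norm_bound_integral[of f "UNIV - {a..b}" g]
  show ?thesis by (auto simp: has_integral_iff)
qed

lemma integral_symmetric_interval_tendsto:
  fixes f :: "real \<Rightarrow> 'a::banach"
  assumes "f integrable_on UNIV"
  shows "(\<lambda>n. integral {- real n..real n} f) \<longlonglongrightarrow> integral UNIV f"
proof (rule LIMSEQ_I)
  fix e :: real assume "0 < e"
  moreover have "(f has_integral integral UNIV f) UNIV"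
    using assms by (rule integrable_integral)
  ultimately obtain B where B: "\<And>a b. ball 0 B \<subseteq> cbox a b \<Longrightarrow>
      norm (integral (cbox a b) (\<lambda>x. if x \<in> UNIV then f x else 0) - integral UNIV f) < e"
    unfolding has_integral_alt' by meson
  obtain n0 :: nat where "B \<le> real n0" using real_arch_simple by blast
  then have "norm (integral {- real n..real n} f - integral UNIV f) < e" if "n0 \<le> n" for n
  proof -
    have "ball 0 B \<subseteq> cbox (- real n) (real n)"
      using \<open>B \<le> real n0\<close> that by (auto simp: dist_real_def)
    from B[OF this] show ?thesis by simp
  qed
  then show "\<exists>no. \<forall>n\<ge>no. norm (integral {- real n..real n} f - integral UNIV f) < e" by blast
qed

section \<open>A uniform Riemann--Lebesgue lemma\<close>

text \<open>Splitting \<open>h v\<close> into \<open>h c\<close> and \<open>h v - h c\<close>: the oscillation of \<open>h\<close> is bounded trivially, while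
  the constant part is integrated exactly and gains the factor \<open>1 / R\<close>.\<close>

lemma norm_integral_sin_mult_le:
  fixes h :: "real \<Rightarrow> 'a::banach"
  assumes "c \<le> d" "0 < R" and cont: "continuous_on {c..d} h"
    and osc: "\<And>v. v \<in> {c..d} \<Longrightarrow> norm (h v - h c) \<le> \<eta>"
  shows "norm (integral {c..d} (\<lambda>v. sin (R * v) *\<^sub>R h v)) \<le> \<eta> * (d - c) + 2 / R * norm (h c)"
proof -
  have "((\<lambda>v. sin (R * v)) has_integral (- cos (R * d) / R) - (- cos (R * c) / R)) {c..d}"
    using assms(1,2) by (intro fundamental_theorem_of_calculus)
      (auto intro!: derivative_eq_intros simp flip: has_real_derivative_iff_has_vector_derivative)
  then have const: "((\<lambda>v. sin (R * v) *\<^sub>R h c) has_integral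
      ((cos (R * c) - cos (R * d)) / R) *\<^sub>R h c) {c..d}"
    by (intro has_integral_scaleR_left) (simp add: diff_divide_distrib)
  have diff: "(\<lambda>v. sin (R * v) *\<^sub>R (h v - h c)) integrable_on {c..d}"
    by (intro integrable_continuous_real continuous_intros cont)
  have "integral {c..d} (\<lambda>v. sin (R * v) *\<^sub>R h v)
      = integral {c..d} (\<lambda>v. sin (R * v) *\<^sub>R (h v - h c) + sin (R * v) *\<^sub>R h c)"
    by (simp add: algebra_simps)
  also have "\<dots> = integral {c..d} (\<lambda>v. sin (R * v) *\<^sub>R (h v - h c))
      + ((cos (R * c) - cos (R * d)) / R) *\<^sub>R h c"
    using diff const by (subst Henstock_Kurzweil_Integration.integral_add) (auto simp: has_integral_iff)
  also have "norm \<dots> \<le> \<eta> * (d - c) + 2 / R * norm (h c)"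
  proof (rule norm_triangle_mono)
    show "norm (integral {c..d} (\<lambda>v. sin (R * v) *\<^sub>R (h v - h c))) \<le> \<eta> * (d - c)"
    proof (rule integral_bound[OF \<open>c \<le> d\<close>])
      show "continuous_on {c..d} (\<lambda>v. sin (R * v) *\<^sub>R (h v - h c))"
        by (intro continuous_intros cont)
      fix v assume "v \<in> {c..d}"
      then show "norm (sin (R * v) *\<^sub>R (h v - h c)) \<le> \<eta>"
        using osc[of v] mult_right_mono[OF abs_sin_le_one[of "R * v"], of "norm (h v - h c)"] by simp
    qed
    have "\<bar>cos (R * c) - cos (R * d)\<bar> \<le> 2"
      using abs_cos_le_one[of "R * c"] abs_cos_le_one[of "R * d"] by linarith
    then have "\<bar>(cos (R * c) - cos (R * d)) / R\<bar> \<le> 2 / R"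
      using \<open>0 < R\<close> by (simp add: abs_divide divide_right_mono)
    then show "norm (((cos (R * c) - cos (R * d)) / R) *\<^sub>R h c) \<le> 2 / R * norm (h c)"
      unfolding norm_scaleR by (rule mult_right_mono) simp
  qed
  finally show ?thesis .
qed

text \<open>By joint uniform continuity, the interval can be cut into pieces whose number and size do not
  depend on \<open>t\<close> and on which every \<open>h t\<close> oscillates by at most \<open>e / 2\<close>; on each piece the
  previous lemma applies.\<close>

lemma riemann_lebesgue_uniform:
  fixes h :: "'b::metric_space \<Rightarrow> real \<Rightarrow> 'a::banach"
  assumes K: "compact K" and cont: "continuous_on (K \<times> {a..b}) (\<lambda>(t, v). h t v)"
  shows "uniform_limit K (\<lambda>R t. integral {a..b} (\<lambda>v. sin (R * v) *\<^sub>R h t v)) (\<lambda>_. 0) at_top"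
proof (cases "a \<le> b")
  case True
  have comp: "compact (K \<times> {a..b})" using K by (intro compact_Times) auto
  obtain M where M: "0 < M" "\<And>t v. t \<in> K \<Longrightarrow> v \<in> {a..b} \<Longrightarrow> norm (h t v) \<le> M"
    using compact_imp_bounded[OF compact_continuous_image[OF cont comp]]
    unfolding bounded_pos by fast
  have slice: "continuous_on {c..d} (h t)" if "t \<in> K" "a \<le> c" "d \<le> b" for t c d
    using that by (intro continuous_on_compose2[OF cont, where f = "\<lambda>v. (t, v)", simplified])
      (auto intro!: continuous_intros)
  have bound: "\<forall>\<^sub>F R in at_top. \<forall>t\<in>K. norm (integral {a..b} (\<lambda>v. sin (R * v) *\<^sub>R h t v)) \<le> e * (b - a)"
    if e: "0 < e" for e
  proof -
    obtain \<delta> where \<delta>: "0 < \<delta>" "\<And>p q. p \<in> K \<times> {a..b} \<Longrightarrow> q \<in> K \<times> {a..b} \<Longrightarrow> dist q p < \<delta> \<Longrightarrow>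
        dist (case q of (t, v) \<Rightarrow> h t v) (case p of (t, v) \<Rightarrow> h t v) < e / 2"
      using compact_uniformly_continuous[OF cont comp] e
      unfolding uniformly_continuous_on_def by (metis half_gt_zero)
    \<comment> \<open>The bound is proportional to the length of the interval, hence additive over adjacent intervals; bisection reduces it to short intervals.\<close>
    define P where "P = (\<lambda>c d. a \<le> c \<longrightarrow> d \<le> b \<longrightarrow> (\<forall>\<^sub>F R in at_top. \<forall>t\<in>K.
        norm (integral {c..d} (\<lambda>v. sin (R * v) *\<^sub>R h t v)) \<le> e * (d - c)))"
    have "P a b"
      using True
    proof (induction rule: Bolzano)
      case (trans x y z)
      show ?case
        unfolding P_def
      proof (intro impI)
        assume xz: "a \<le> x" "z \<le> b"
        with trans have "\<forall>\<^sub>F R in at_top. \<forall>t\<in>K.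
            norm (integral {x..y} (\<lambda>v. sin (R * v) *\<^sub>R h t v)) \<le> e * (y - x)"
          "\<forall>\<^sub>F R in at_top. \<forall>t\<in>K.
            norm (integral {y..z} (\<lambda>v. sin (R * v) *\<^sub>R h t v)) \<le> e * (z - y)"
          by (auto simp: P_def)
        then show "\<forall>\<^sub>F R in at_top. \<forall>t\<in>K.
            norm (integral {x..z} (\<lambda>v. sin (R * v) *\<^sub>R h t v)) \<le> e * (z - x)"
        proof eventually_elim
          case (elim R)
          show ?case
          proof
            fix t assume t: "t \<in> K"
            have "integral {x..z} (\<lambda>v. sin (R * v) *\<^sub>R h t v) =
                integral {x..y} (\<lambda>v. sin (R * v) *\<^sub>R h t v) + integral {y..z} (\<lambda>v. sin (R * v) *\<^sub>R h t v)"
              using trans xz t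
              by (intro Henstock_Kurzweil_Integration.integral_combine[symmetric] integrable_continuous_real
                  continuous_intros slice) auto
            also have "norm \<dots> \<le> e * (y - x) + e * (z - y)"
              using elim t by (intro norm_triangle_mono) auto
            finally show "norm (integral {x..z} (\<lambda>v. sin (R * v) *\<^sub>R h t v)) \<le> e * (z - x)"
              by (simp add: algebra_simps)
          qed
        qed
      qed
    next
      case (local x)
      have "P c d" if cd: "c \<le> x" "x \<le> d" "d - c < \<delta>" for c d
      proof (cases "c = d")
        case False
        then have "c < d" using cd by simp
        show ?thesis
          unfolding P_def
        proof (intro impI)
          assume ab: "a \<le> c" "d \<le> b"
          \<comment> \<open>From this \<open>R\<close> on, \<open>2 M / R\<close> is at most \<open>e / 2 * (d - c)\<close>.\<close>
          show "\<forall>\<^sub>F R in at_top. \<forall>t\<in>K.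
            norm (integral {c..d} (\<lambda>v. sin (R * v) *\<^sub>R h t v)) \<le> e * (d - c)"
            using eventually_gt_at_top[of 0] eventually_ge_at_top[of "4 * M / (e * (d - c))"]
          proof eventually_elim
            case (elim R)
            show ?case
            proof
              fix t assume t: "t \<in> K"
              have "norm (h t v - h t c) \<le> e / 2" if "v \<in> {c..d}" for v
                using \<delta>(2)[of "(t, c)" "(t, v)"] that t cd ab
                by (force simp: dist_norm dist_Pair_Pair)
              then have "norm (integral {c..d} (\<lambda>v. sin (R * v) *\<^sub>R h t v))
                  \<le> e / 2 * (d - c) + 2 / R * norm (h t c)"
                using \<open>c < d\<close> elim t ab by (intro norm_integral_sin_mult_le slice) auto
              also have "2 / R * norm (h t c) \<le> 2 / R * M"
                using elim t ab \<open>c < d\<close> by (intro mult_left_mono M) auto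
              also have "2 / R * M \<le> e / 2 * (d - c)"
                using elim e \<open>c < d\<close> by (simp add: field_simps)
              finally show "norm (integral {c..d} (\<lambda>v. sin (R * v) *\<^sub>R h t v)) \<le> e * (d - c)"
                by simp
            qed
          qed
        qed
      qed (simp add: P_def)
      with \<delta>(1) show ?case by blast
    qed
    then show ?thesis by (simp add: P_def)
  qed
  show ?thesis
  proof (rule uniform_limitI)
    fix e :: real assume e: "0 < e"
    have lt: "e / (b - a + 1) * (b - a) < e"
      using e True by (simp add: field_simps)
    have "0 < e / (b - a + 1)" using e True by simp
    from bound[OF this]
    show "\<forall>\<^sub>F R in at_top. \<forall>t\<in>K. dist (integral {a..b} (\<lambda>v. sin (R * v) *\<^sub>R h t v)) 0 < e"
      by eventually_elim (use lt in \<open>auto simp: dist_norm intro: le_less_trans\<close>)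
  qed
qed (simp add: uniform_limit_const)

section \<open>Partial Fourier inversion as convolution with the Dirichlet kernel\<close>

lemma continuous_on_if_locally_Holder:
  assumes "locally_Holder F"
  shows "continuous_on UNIV F"
proof (rule continuous_at_imp_continuous_on, rule ballI)
  fix x :: real
  obtain \<alpha> C where \<alpha>: "0 < \<alpha>" "0 < C"
    and H: "\<And>y z. y \<in> {x-1..x+1} \<Longrightarrow> z \<in> {x-1..x+1} \<Longrightarrow> norm (F y - F z) \<le> C * \<bar>y - z\<bar> powr \<alpha>"
    using assms compact_Icc[of "x - 1" "x + 1"] unfolding locally_Holder_def by meson
  have "((\<lambda>y. F y - F x) \<longlongrightarrow> 0) (at x)"
  proof (rule Lim_null_comparison)
    show "\<forall>\<^sub>F y in at x. norm (F y - F x) \<le> C * \<bar>y - x\<bar> powr \<alpha>"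
      unfolding eventually_at
      by (intro exI[of _ 1]) (auto intro!: H simp: dist_real_def)
    have "((\<lambda>y. C * \<bar>y - x\<bar> powr \<alpha>) \<longlongrightarrow> C * \<bar>x - x\<bar> powr \<alpha>) (at x)"
      by (intro tendsto_intros tendsto_powr') (use \<alpha> in auto)
    then show "((\<lambda>y. C * \<bar>y - x\<bar> powr \<alpha>) \<longlongrightarrow> 0) (at x)" using \<alpha> by simp
  qed
  then show "isCont F x"
    by (simp add: isCont_def LIM_zero_iff)
qed

context
  fixes F :: "real \<Rightarrow> 'a::complex_banach"
  assumes cont: "continuous_on UNIV F" and int: "(\<lambda>x. norm (F x)) integrable_on UNIV"
begin

private lemma cont_compose: "continuous_on S f \<Longrightarrow> continuous_on S (\<lambda>x. F (f x))"
  by (rule continuous_on_compose2[OF cont]) auto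

lemma fourier_eq_integral: "fourier F k = integral UNIV (\<lambda>s. cis (- (k * s)) *\<^sub>C F s)"
proof -
  have "continuous_on UNIV (\<lambda>s. cis (- (k * s)) *\<^sub>C F s)"
    by (intro continuous_intros cont_compose)
  moreover from this have "(\<lambda>s. cis (- (k * s)) *\<^sub>C F s) integrable_on UNIV"
    by (rule integrable_on_UNIV_if_dominated[OF _ _ int]) simp
  ultimately have "Bochner_integral (lebesgue_on UNIV) (\<lambda>s. cis (- (k * s)) *\<^sub>C F s)
      = integral UNIV (\<lambda>s. cis (- (k * s)) *\<^sub>C F s)"
    using int by (intro Bochner_integral_continuous) simp_all
  then show ?thesis
    by (simp add: fourier_def lebesgue_on_UNIV_eq cis_conv_exp mult.assoc)
qed

text \<open>The right-hand side is the integral of the norm of \<open>F\<close> off \<open>{-N..N}\<close>. It is independent of the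
  frequency \<open>k\<close>, so the truncated transforms converge uniformly.\<close>

lemma norm_fourier_truncation_le:
  "norm (fourier F k - integral {-N..N} (\<lambda>s. cis (- (k * s)) *\<^sub>C F s))
    \<le> integral UNIV (\<lambda>s. norm (F s)) - integral {-N..N} (\<lambda>s. norm (F s))"
  unfolding fourier_eq_integral
proof (rule norm_integral_tail_le)
  have "continuous_on UNIV (\<lambda>s. cis (- (k * s)) *\<^sub>C F s)"
    by (intro continuous_intros cont_compose)
  then show "(\<lambda>s. cis (- (k * s)) *\<^sub>C F s) integrable_on UNIV"
    by (rule integrable_on_UNIV_if_dominated[OF _ _ int]) simp
qed (auto intro!: int integrable_continuous_real continuous_intros cont_compose)

lemma continuous_on_truncated_fourier:
  "continuous_on S (\<lambda>k. integral {-N..N} (\<lambda>s. cis (- (k * s)) *\<^sub>C F s))"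
proof -
  have "continuous_on (S \<times> cbox (-N) N) (\<lambda>(k, s). cis (- (k * s)) *\<^sub>C F s)"
    by (auto simp: case_prod_unfold intro!: continuous_intros cont_compose)
  from integral_continuous_on_param[OF this] show ?thesis by simp
qed

lemma continuous_on_fourier: "continuous_on UNIV (fourier F)"
proof (rule uniform_limit_theorem[of _ "\<lambda>n k. integral {- real n..real n} (\<lambda>s. cis (- (k * s)) *\<^sub>C F s)" sequentially])
  show "\<forall>\<^sub>F n in sequentially. continuous_on UNIV
      (\<lambda>k. integral {- real n..real n} (\<lambda>s. cis (- (k * s)) *\<^sub>C F s))"
  proof (intro always_eventually allI)
    fix n
    show "continuous_on UNIV (\<lambda>k. integral {- real n..real n} (\<lambda>s. cis (- (k * s)) *\<^sub>C F s))"
      by (rule continuous_on_truncated_fourier)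
  qed
  show "uniform_limit UNIV (\<lambda>n k. integral {- real n..real n} (\<lambda>s. cis (- (k * s)) *\<^sub>C F s)) (fourier F) sequentially"
  proof (rule uniform_limitI)
    fix e :: real assume "0 < e"
    from tendstoD[OF integral_symmetric_interval_tendsto[OF int] this]
    show "\<forall>\<^sub>F n in sequentially. \<forall>k\<in>UNIV.
        dist (integral {- real n..real n} (\<lambda>s. cis (- (k * s)) *\<^sub>C F s)) (fourier F k) < e"
    proof eventually_elim
      case (elim n)
      show ?case
      proof
        fix k
        show "dist (integral {- real n..real n} (\<lambda>s. cis (- (k * s)) *\<^sub>C F s)) (fourier F k) < e"
          using norm_fourier_truncation_le[of k "real n"] elim by (simp add: dist_norm norm_minus_commute)
      qed
    qed
  qed
qed simp

text \<open>On the rectangle the integrand is continuous, so the order of integration can be exchanged; the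
  inner integral of \<open>cis (s (t - u))\<close> is then the Dirichlet kernel.\<close>

lemma integral_truncated_fourier:
  assumes R: "0 \<le> R"
  shows "integral {-R..R} (\<lambda>s. cis (s * t) *\<^sub>C integral {-N..N} (\<lambda>u. cis (- (s * u)) *\<^sub>C F u))
    = integral {-N..N} (\<lambda>u. (2 * pi * dirichlet_kernel R (t - u)) *\<^sub>R F u)"
proof -
  have "cis (s * t) *\<^sub>C integral {-N..N} (\<lambda>u. cis (- (s * u)) *\<^sub>C F u)
      = integral {-N..N} (\<lambda>u. cis (s * (t - u)) *\<^sub>C F u)" for s
  proof -
    have "(\<lambda>u. cis (- (s * u)) *\<^sub>C F u) integrable_on {-N..N}"
      by (intro integrable_continuous_real continuous_intros cont_compose)
    from integral_linear[OF this bounded_bilinear.bounded_linear_right[OF bounded_bilinear_scaleC, of "cis (s * t)"]]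
    show ?thesis
      by (simp add: o_def scaleC_scaleC cis_mult algebra_simps)
  qed
  then have "integral {-R..R} (\<lambda>s. cis (s * t) *\<^sub>C integral {-N..N} (\<lambda>u. cis (- (s * u)) *\<^sub>C F u))
      = integral {-R..R} (\<lambda>s. integral {-N..N} (\<lambda>u. cis (s * (t - u)) *\<^sub>C F u))"
    by simp
  also have "\<dots> = integral {-N..N} (\<lambda>u. integral {-R..R} (\<lambda>s. cis (s * (t - u)) *\<^sub>C F u))"
    using integral_swap_continuous[of "-R" "-N" R N "\<lambda>s u. cis (s * (t - u)) *\<^sub>C F u"]
    by (simp add: case_prod_unfold continuous_intros cont_compose)
  also have "(\<lambda>u. integral {-R..R} (\<lambda>s. cis (s * (t - u)) *\<^sub>C F u))
      = (\<lambda>u. (2 * pi * dirichlet_kernel R (t - u)) *\<^sub>R F u)"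
  proof
    fix u
    show "integral {-R..R} (\<lambda>s. cis (s * (t - u)) *\<^sub>C F u) = (2 * pi * dirichlet_kernel R (t - u)) *\<^sub>R F u"
    using has_integral_linear[OF has_integral_cis_dirichlet_kernel[OF R, of "t - u"]
        bounded_bilinear.bounded_linear_left[OF bounded_bilinear_scaleC, of "F u"]]
    by (simp add: o_def has_integral_iff scaleR_scaleC)
  qed
  finally show ?thesis .
qed

text \<open>Passing to the limit \<open>N \<rightarrow> \<infinity>\<close> in the truncated identity: the left-hand side converges because the
  truncated transforms converge uniformly on \<open>{-R..R}\<close>, the right-hand side because the Dirichlet
  kernel is bounded by \<open>R / \<pi>\<close>.\<close>

lemma partial_fourier_inversion:
  assumes R: "0 \<le> R"
  shows "(1 / (2 * pi)) *\<^sub>R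
      Bochner_integral (lebesgue_on {-R..R}) (\<lambda>s. exp (\<i> * of_real s * of_real t) *\<^sub>C fourier F s)
    = integral UNIV (\<lambda>u. dirichlet_kernel R (t - u) *\<^sub>R F u)"
proof -
  note continuous_on_compose2[OF continuous_on_fourier _ subset_UNIV, continuous_intros]
  let ?I = "\<lambda>n k. integral {- real n..real n} (\<lambda>u. cis (- (k * u)) *\<^sub>C F u)"
  let ?T = "\<lambda>n. integral UNIV (\<lambda>s. norm (F s)) - integral {- real n..real n} (\<lambda>s. norm (F s))"
  have cI: "continuous_on {-R..R} (?I n)" for n
    by (rule continuous_on_truncated_fourier)
  have T0: "?T \<longlonglongrightarrow> 0"
    using tendsto_diff[OF tendsto_const[of "integral UNIV (\<lambda>s. norm (F s))"] integral_symmetric_interval_tendsto[OF int]] by simp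
  have "(\<lambda>n. integral {-R..R} (\<lambda>s. cis (s * t) *\<^sub>C ?I n s)
      - integral {-R..R} (\<lambda>s. cis (s * t) *\<^sub>C fourier F s)) \<longlonglongrightarrow> 0"
  proof (rule Lim_null_comparison)
    show "\<forall>\<^sub>F n in sequentially. norm (integral {-R..R} (\<lambda>s. cis (s * t) *\<^sub>C ?I n s)
      - integral {-R..R} (\<lambda>s. cis (s * t) *\<^sub>C fourier F s)) \<le> ?T n * (R - (- R))"
    proof (intro always_eventually allI)
      fix n
      have "integral {-R..R} (\<lambda>s. cis (s * t) *\<^sub>C ?I n s) - integral {-R..R} (\<lambda>s. cis (s * t) *\<^sub>C fourier F s)
          = integral {-R..R} (\<lambda>s. cis (s * t) *\<^sub>C ?I n s - cis (s * t) *\<^sub>C fourier F s)"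
        by (intro Henstock_Kurzweil_Integration.integral_diff[symmetric] integrable_continuous_real
            continuous_intros cont_compose cI)
      also have "norm \<dots> \<le> ?T n * (R - (- R))"
      proof (rule integral_bound)
        show "continuous_on {-R..R} (\<lambda>s. cis (s * t) *\<^sub>C ?I n s - cis (s * t) *\<^sub>C fourier F s)"
          by (intro continuous_intros cont_compose cI)
        fix s
        have "cis (s * t) *\<^sub>C ?I n s - cis (s * t) *\<^sub>C fourier F s = cis (s * t) *\<^sub>C (?I n s - fourier F s)"
          by (rule bounded_bilinear.diff_right[OF bounded_bilinear_scaleC, symmetric])
        then show "norm (cis (s * t) *\<^sub>C ?I n s - cis (s * t) *\<^sub>C fourier F s) \<le> ?T n"
          using norm_fourier_truncation_le[of s "real n"] by (simp add: norm_minus_commute)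
      qed (use R in simp)
      finally show "norm (integral {-R..R} (\<lambda>s. cis (s * t) *\<^sub>C ?I n s)
        - integral {-R..R} (\<lambda>s. cis (s * t) *\<^sub>C fourier F s)) \<le> ?T n * (R - (- R))" .
    qed
    show "(\<lambda>n. ?T n * (R - (- R))) \<longlonglongrightarrow> 0"
      using T0 by (rule tendsto_mult_left_zero)
  qed
  then have lim1: "(\<lambda>n. integral {-R..R} (\<lambda>s. cis (s * t) *\<^sub>C ?I n s))
      \<longlonglongrightarrow> integral {-R..R} (\<lambda>s. cis (s * t) *\<^sub>C fourier F s)"
    by (simp add: LIM_zero_iff)
  have kint: "(\<lambda>u. dirichlet_kernel R (t - u) *\<^sub>R F u) integrable_on UNIV"
  proof (rule integrable_on_UNIV_if_dominated)
    show "norm (dirichlet_kernel R (t - u) *\<^sub>R F u) \<le> R / pi * norm (F u)" for u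
      using abs_dirichlet_kernel_le[of R "t - u"] R by (simp add: mult_right_mono del: times_divide_eq_left)
  qed (intro continuous_intros cont_compose integrable_on_mult_right int)+
  then have "(\<lambda>u. (2 * pi) *\<^sub>R (dirichlet_kernel R (t - u) *\<^sub>R F u)) integrable_on UNIV"
    by (rule integrable_cmul)
  then have lim2: "(\<lambda>n. integral {- real n..real n} (\<lambda>u. (2 * pi * dirichlet_kernel R (t - u)) *\<^sub>R F u))
      \<longlonglongrightarrow> (2 * pi) *\<^sub>R integral UNIV (\<lambda>u. dirichlet_kernel R (t - u) *\<^sub>R F u)"
    using integral_symmetric_interval_tendsto unfolding integral_cmul[symmetric] by fastforce
  have "integral {-R..R} (\<lambda>s. cis (s * t) *\<^sub>C fourier F s)
      = (2 * pi) *\<^sub>R integral UNIV (\<lambda>u. dirichlet_kernel R (t - u) *\<^sub>R F u)"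
    by (rule LIMSEQ_unique[OF lim1 lim2[folded integral_truncated_fourier[OF R]]])
  moreover have "Bochner_integral (lebesgue_on {-R..R}) (\<lambda>s. cis (s * t) *\<^sub>C fourier F s)
      = integral {-R..R} (\<lambda>s. cis (s * t) *\<^sub>C fourier F s)"
    by (rule Bochner_integral_continuous)
      (auto intro!: integrable_continuous_real continuous_intros cont_compose)
  moreover have "(\<lambda>s. exp (\<i> * of_real s * of_real t) *\<^sub>C fourier F s) = (\<lambda>s. cis (s * t) *\<^sub>C fourier F s)"
    by (simp add: cis_conv_exp mult.assoc)
  ultimately show ?thesis by simp
qed

section \<open>Localisation of the Dirichlet integral\<close>

lemma norm_dirichlet_tail_le:
  assumes N: "0 < N"
  shows "norm (integral UNIV (\<lambda>u. dirichlet_kernel R (t - u) *\<^sub>R F u)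
      - integral {t-N..t+N} (\<lambda>u. dirichlet_kernel R (t - u) *\<^sub>R F u))
    \<le> 1 / (pi * N) * integral UNIV (\<lambda>u. norm (F u))"
proof -
  have "norm (integral UNIV (\<lambda>u. dirichlet_kernel R (t - u) *\<^sub>R F u)
      - integral {t-N..t+N} (\<lambda>u. dirichlet_kernel R (t - u) *\<^sub>R F u))
    \<le> integral UNIV (\<lambda>u. 1 / (pi * N) * norm (F u)) - integral {t-N..t+N} (\<lambda>u. 1 / (pi * N) * norm (F u))"
  proof (rule norm_integral_tail_le)
    show "(\<lambda>u. dirichlet_kernel R (t - u) *\<^sub>R F u) integrable_on UNIV"
    proof (rule integrable_on_UNIV_if_dominated)
      show "norm (dirichlet_kernel R (t - u) *\<^sub>R F u) \<le> \<bar>R\<bar> / pi * norm (F u)" for u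
        using abs_dirichlet_kernel_le[of R "t - u"] by (simp add: mult_right_mono del: times_divide_eq_left)
    qed (intro continuous_intros cont_compose integrable_on_mult_right int)+
    fix u assume "u \<notin> {t-N..t+N}"
    then have "t - u \<noteq> 0" "N \<le> \<bar>t - u\<bar>" using N by auto
    then have "\<bar>dirichlet_kernel R (t - u)\<bar> \<le> 1 / (pi * \<bar>t - u\<bar>)"
      by (intro abs_dirichlet_kernel_le_inverse)
    also have "\<dots> \<le> 1 / (pi * N)"
      using N \<open>N \<le> \<bar>t - u\<bar>\<close> by (intro divide_left_mono mult_left_mono) auto
    finally show "norm (dirichlet_kernel R (t - u) *\<^sub>R F u) \<le> 1 / (pi * N) * norm (F u)"
      unfolding norm_scaleR by (rule mult_right_mono) simp
  qed (intro integrable_on_mult_right int integrable_continuous_real continuous_intros cont_compose)+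
  also have "\<dots> \<le> integral UNIV (\<lambda>u. 1 / (pi * N) * norm (F u))"
    using N by (simp add: Henstock_Kurzweil_Integration.integral_nonneg integrable_continuous_real continuous_intros cont_compose)
  finally show ?thesis by simp
qed

text \<open>The kernel is even, so the two halves of the interval around \<open>t\<close> can be laid on top of each other.
  This leaves one singularity, at an endpoint, and one region for the Riemann--Lebesgue lemma.\<close>

lemma integral_dirichlet_fold:
  assumes N: "0 \<le> N"
  shows "integral {t-N..t+N} (\<lambda>u. dirichlet_kernel R (t - u) *\<^sub>R F u)
    = integral {0..N} (\<lambda>v. dirichlet_kernel R v *\<^sub>R (F (t + v) + F (t - v)))"
proof -
  let ?f = "\<lambda>u. dirichlet_kernel R (t - u) *\<^sub>R F u"
  have right: "integral {t..t+N} ?f = integral {0..N} (\<lambda>v. dirichlet_kernel R v *\<^sub>R F (t + v))"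
    using integral_shift_Icc_real[of 0 N ?f t] by (simp add: o_def add.commute)
  have "integral {t-N..t} ?f = integral {-N..0} (\<lambda>v. dirichlet_kernel R v *\<^sub>R F (t + v))"
    using integral_shift_Icc_real[of "-N" 0 ?f t] by (simp add: o_def add.commute)
  also have "\<dots> = integral {0..N} (\<lambda>v. dirichlet_kernel R v *\<^sub>R F (t - v))"
    using Henstock_Kurzweil_Integration.integral_reflect_real[of N 0 "\<lambda>v. dirichlet_kernel R v *\<^sub>R F (t - v)"] by simp
  finally have left: "integral {t-N..t} ?f = integral {0..N} (\<lambda>v. dirichlet_kernel R v *\<^sub>R F (t - v))" .
  have "integral {t-N..t+N} ?f = integral {t-N..t} ?f + integral {t..t+N} ?f"
    using N by (intro Henstock_Kurzweil_Integration.integral_combine[symmetric] integrable_continuous_real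
        continuous_intros cont_compose) auto
  then show ?thesis
    unfolding left right scaleR_add_right
    by (subst Henstock_Kurzweil_Integration.integral_add)
      (auto intro!: integrable_continuous_real continuous_intros cont_compose)
qed

text \<open>The kernel is at most \<open>1 / (\<pi> v)\<close> in absolute value, whatever \<open>R\<close> is, and the Hoelder condition turns
  this into the integrable singularity \<open>v powr (\<alpha> - 1)\<close>.\<close>

lemma norm_integral_dirichlet_near_le:
  assumes \<delta>: "0 \<le> \<delta>" and \<alpha>: "0 < \<alpha>" and C: "0 \<le> C"
    and H: "\<And>v. 0 \<le> v \<Longrightarrow> v \<le> \<delta> \<Longrightarrow> norm (F (t + v) - F t) \<le> C * v powr \<alpha>"
      "\<And>v. 0 \<le> v \<Longrightarrow> v \<le> \<delta> \<Longrightarrow> norm (F (t - v) - F t) \<le> C * v powr \<alpha>"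
  shows "norm (integral {0..\<delta>} (\<lambda>v. dirichlet_kernel R v *\<^sub>R (F (t + v) + F (t - v) - 2 *\<^sub>R F t)))
    \<le> 2 * C / pi * (\<delta> powr \<alpha> / \<alpha>)"
proof -
  have I: "((\<lambda>v. 2 * C / pi * v powr (\<alpha> - 1)) has_integral 2 * C / pi * (\<delta> powr \<alpha> / \<alpha>)) {0..\<delta>}"
    using has_integral_mult_right[OF has_integral_powr_from_0[of "\<alpha> - 1" \<delta>], of "2 * C / pi"] \<alpha> \<delta> by simp
  have "norm (integral {0..\<delta>} (\<lambda>v. dirichlet_kernel R v *\<^sub>R (F (t + v) + F (t - v) - 2 *\<^sub>R F t)))
      \<le> integral {0..\<delta>} (\<lambda>v. 2 * C / pi * v powr (\<alpha> - 1))"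
  proof (rule Henstock_Kurzweil_Integration.integral_norm_bound_integral)
    show "(\<lambda>v. dirichlet_kernel R v *\<^sub>R (F (t + v) + F (t - v) - 2 *\<^sub>R F t)) integrable_on {0..\<delta>}"
      by (intro integrable_continuous_real continuous_intros cont_compose)
    show "(\<lambda>v. 2 * C / pi * v powr (\<alpha> - 1)) integrable_on {0..\<delta>}"
      using I by (auto simp: has_integral_iff)
    fix v assume v: "v \<in> {0..\<delta>}"
    show "norm (dirichlet_kernel R v *\<^sub>R (F (t + v) + F (t - v) - 2 *\<^sub>R F t)) \<le> 2 * C / pi * v powr (\<alpha> - 1)"
    proof (cases "v = 0")
      case False
      with v have "0 < v" by simp
      have "F (t + v) + F (t - v) - 2 *\<^sub>R F t = (F (t + v) - F t) + (F (t - v) - F t)"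
        by (simp add: scaleR_2)
      also have "norm \<dots> \<le> C * v powr \<alpha> + C * v powr \<alpha>"
        using v by (intro norm_triangle_mono H) auto
      finally have "norm (F (t + v) + F (t - v) - 2 *\<^sub>R F t) \<le> 2 * C * v powr \<alpha>" by simp
      moreover have "\<bar>dirichlet_kernel R v\<bar> \<le> 1 / (pi * v)"
        using abs_dirichlet_kernel_le_inverse[of v R] \<open>0 < v\<close> by simp
      ultimately have "norm (dirichlet_kernel R v *\<^sub>R (F (t + v) + F (t - v) - 2 *\<^sub>R F t))
          \<le> 1 / (pi * v) * (2 * C * v powr \<alpha>)"
        unfolding norm_scaleR using \<open>0 < v\<close> by (intro mult_mono) auto
      also have "\<dots> = 2 * C / pi * v powr (\<alpha> - 1)"
        using \<open>0 < v\<close> by (simp add: powr_diff)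
      finally show ?thesis .
    qed (simp add: scaleR_2)
  qed
  with I show ?thesis by (simp add: has_integral_iff)
qed

text \<open>Away from \<open>v = 0\<close> the factor \<open>1 / (\<pi> v)\<close> of the kernel is continuous and can be moved into the
  amplitude of the oscillating factor \<open>sin (R v)\<close>.\<close>

lemma dirichlet_far_tendsto:
  assumes \<delta>: "0 < \<delta>" and K: "compact K"
  shows "uniform_limit K (\<lambda>R t. integral {\<delta>..N}
    (\<lambda>v. dirichlet_kernel R v *\<^sub>R (F (t + v) + F (t - v) - 2 *\<^sub>R F t))) (\<lambda>_. 0) at_top"
proof -
  have "continuous_on (K \<times> {\<delta>..N}) (\<lambda>(t, v). (1 / (pi * v)) *\<^sub>R (F (t + v) + F (t - v) - 2 *\<^sub>R F t))"
    using \<delta> by (auto simp: case_prod_unfold intro!: continuous_intros cont_compose)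
  from riemann_lebesgue_uniform[OF K this]
  have "uniform_limit K (\<lambda>R t. integral {\<delta>..N} (\<lambda>v. sin (R * v) *\<^sub>R
      ((1 / (pi * v)) *\<^sub>R (F (t + v) + F (t - v) - 2 *\<^sub>R F t)))) (\<lambda>_. 0) at_top" .
  moreover have "integral {\<delta>..N} (\<lambda>v. sin (R * v) *\<^sub>R
      ((1 / (pi * v)) *\<^sub>R (F (t + v) + F (t - v) - 2 *\<^sub>R F t)))
    = integral {\<delta>..N} (\<lambda>v. dirichlet_kernel R v *\<^sub>R (F (t + v) + F (t - v) - 2 *\<^sub>R F t))" for R t
    using \<delta> by (intro Henstock_Kurzweil_Integration.integral_cong)
      (auto simp: dirichlet_kernel_def mult.commute)
  ultimately show ?thesis by simp
qed

end

section \<open>Locally uniform Fourier inversion\<close>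

lemma dirichlet_integral_tendsto_uniformly:
  fixes F :: "real \<Rightarrow> 'a::complex_banach"
  assumes Holder: "locally_Holder F" and int: "(\<lambda>x. norm (F x)) integrable_on UNIV"
    and K: "compact K"
  shows "uniform_limit K (\<lambda>R t. integral UNIV (\<lambda>u. dirichlet_kernel R (t - u) *\<^sub>R F u)) F at_top"
proof (rule uniform_limitI)
  fix e :: real assume e: "0 < e"
  note cont = continuous_on_if_locally_Holder[OF Holder]
  have [continuous_intros]: "continuous_on S (\<lambda>x. F (f x))" if "continuous_on S f"
    for S :: "real set" and f
    using that by (rule continuous_on_compose2[OF cont]) auto
  let ?L = "integral UNIV (\<lambda>u. norm (F u))"
  have L: "0 \<le> ?L" using int by (simp add: Henstock_Kurzweil_Integration.integral_nonneg)
  obtain M where M: "0 < M" "\<And>t. t \<in> K \<Longrightarrow> norm (F t) \<le> M"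
    using compact_imp_bounded[OF compact_continuous_image[OF continuous_on_subset[OF cont subset_UNIV] K]]
    unfolding bounded_pos by fast
  \<comment> \<open>Makes the tail beyond \<open>N\<close> at most \<open>e / 4\<close>; the summand \<open>1\<close> ensures \<open>\<delta> < N\<close> below.\<close>
  define N where "N = 1 + 4 * ?L / e"
  have N: "1 \<le> N" "1 / (pi * N) * ?L \<le> e / 4"
  proof -
    show "1 \<le> N" using L e by (simp add: N_def)
    have "4 * ?L \<le> e * N" using e by (simp add: N_def field_simps)
    also have "\<dots> \<le> e * (pi * N)"
      using e \<open>1 \<le> N\<close> pi_gt3 by (intro mult_left_mono) auto
    finally show "1 / (pi * N) * ?L \<le> e / 4"
      using \<open>1 \<le> N\<close> by (simp add: field_simps)
  qed
  \<comment> \<open>One pair of Hoelder constants serves all \<open>t\<close> in \<open>K\<close> and all increments up to \<open>1\<close>.\<close>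
  have "compact ((\<lambda>(t, v). t + v) ` (K \<times> {-1..1::real}))"
    using K by (intro compact_continuous_image compact_Times)
      (auto simp: case_prod_unfold intro!: continuous_intros)
  then obtain \<alpha> C where \<alpha>: "0 < \<alpha>" and C: "0 < C"
    and H: "\<And>x y. x \<in> (\<lambda>(t, v). t + v) ` (K \<times> {-1..1}) \<Longrightarrow> y \<in> (\<lambda>(t, v). t + v) ` (K \<times> {-1..1}) \<Longrightarrow>
      norm (F x - F y) \<le> C * \<bar>x - y\<bar> powr \<alpha>"
    using Holder unfolding locally_Holder_def by meson
  have HK: "norm (F (t + v) - F t) \<le> C * \<bar>v\<bar> powr \<alpha>" if "t \<in> K" "\<bar>v\<bar> \<le> 1" for t v
  proof -
    have "t + v \<in> (\<lambda>(t, v). t + v) ` (K \<times> {-1..1})" "t + 0 \<in> (\<lambda>(t, v). t + v) ` (K \<times> {-1..1})"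
      using that by (force intro!: image_eqI[of _ _ "(t, v)"], force intro!: image_eqI[of _ _ "(t, 0)"])
    from H[OF this] show ?thesis by simp
  qed
  have "((\<lambda>\<delta>. 2 * C / pi * (\<delta> powr \<alpha> / \<alpha>)) \<longlongrightarrow> 2 * C / pi * (0 powr \<alpha> / \<alpha>)) (at_right 0)"
    using \<alpha> by (intro tendsto_intros tendsto_powr') (auto simp: eventually_at_right_less intro: eventually_mono[OF eventually_at_right_less])
  then have "\<forall>\<^sub>F \<delta> in at_right 0. 2 * C / pi * (\<delta> powr \<alpha> / \<alpha>) < e / 4"
    using e \<alpha> by (intro order_tendstoD) auto
  moreover have "\<forall>\<^sub>F \<delta> in at_right 0. \<delta> \<in> {0<..<1::real}"
    by (rule eventually_at_right_real) simp
  ultimately have "\<forall>\<^sub>F \<delta> in at_right 0. 2 * C / pi * (\<delta> powr \<alpha> / \<alpha>) < e / 4 \<and> \<delta> \<in> {0<..<1}"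
    by (rule eventually_conj)
  then obtain \<delta> where \<delta>: "0 < \<delta>" "\<delta> < 1" "2 * C / pi * (\<delta> powr \<alpha> / \<alpha>) < e / 4"
    using eventually_happens[of _ "at_right (0::real)"] by auto
  have far: "\<forall>\<^sub>F R in at_top. \<forall>t\<in>K. dist (integral {\<delta>..N}
      (\<lambda>v. dirichlet_kernel R v *\<^sub>R (F (t + v) + F (t - v) - 2 *\<^sub>R F t))) 0 < e / 4"
    using e by (intro uniform_limitD[OF dirichlet_far_tendsto[OF cont int \<delta>(1) K]]) auto
  have "((\<lambda>R. Si (R * N)) \<longlongrightarrow> pi / 2) at_top"
    using N(1) by (intro filterlim_compose[OF Si_at_top] filterlim_at_top_mult_tendsto_pos[OF tendsto_const])
      (auto intro: filterlim_ident)
  then have "((\<lambda>R. (2 * Si (R * N) / pi - 1) * M) \<longlongrightarrow> (2 * (pi / 2) / pi - 1) * M) at_top"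
    by (intro tendsto_intros) auto
  then have main: "\<forall>\<^sub>F R in at_top. dist ((2 * Si (R * N) / pi - 1) * M) 0 < e / 4"
    using e by (intro tendstoD) auto
  show "\<forall>\<^sub>F R in at_top. \<forall>t\<in>K. dist (integral UNIV (\<lambda>u. dirichlet_kernel R (t - u) *\<^sub>R F u)) (F t) < e"
    using far main
  proof eventually_elim
    case (elim R)
    show ?case
    proof
      fix t assume t: "t \<in> K"
      let ?\<Phi> = "\<lambda>v. dirichlet_kernel R v *\<^sub>R (F (t + v) + F (t - v) - 2 *\<^sub>R F t)"
      let ?J = "integral UNIV (\<lambda>u. dirichlet_kernel R (t - u) *\<^sub>R F u)"
      let ?JN = "integral {t-N..t+N} (\<lambda>u. dirichlet_kernel R (t - u) *\<^sub>R F u)"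
      have \<Phi>: "?\<Phi> integrable_on {a..b}" for a b
        by (intro integrable_continuous_real continuous_intros)
      have "?JN = integral {0..N} (\<lambda>v. ?\<Phi> v + dirichlet_kernel R v *\<^sub>R (2 *\<^sub>R F t))"
        using N(1) by (simp add: integral_dirichlet_fold[OF cont int] scaleR_diff_right)
      also have "\<dots> = integral {0..N} ?\<Phi> + (Si (R * N) / pi) *\<^sub>R (2 *\<^sub>R F t)"
        using N(1) by (intro integral_unique has_integral_add integrable_integral[OF \<Phi>]
            has_integral_scaleR_left has_integral_dirichlet_kernel) simp
      also have "integral {0..N} ?\<Phi> = integral {0..\<delta>} ?\<Phi> + integral {\<delta>..N} ?\<Phi>"
        using \<delta> N(1) by (intro Henstock_Kurzweil_Integration.integral_combine[symmetric] \<Phi>) auto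
      finally have "?J - F t = (?J - ?JN) + integral {0..\<delta>} ?\<Phi> + integral {\<delta>..N} ?\<Phi>
          + (2 * Si (R * N) / pi - 1) *\<^sub>R F t"
        by (simp add: algebra_simps)
      moreover have "norm (?J - ?JN) \<le> e / 4"
        using norm_dirichlet_tail_le[OF cont int, of N R t] N by linarith
      moreover have "norm (integral {0..\<delta>} ?\<Phi>) < e / 4"
      proof (rule le_less_trans[OF norm_integral_dirichlet_near_le[OF cont int] \<delta>(3)])
        fix v assume "0 \<le> v" "v \<le> \<delta>"
        then show "norm (F (t + v) - F t) \<le> C * v powr \<alpha>" "norm (F (t - v) - F t) \<le> C * v powr \<alpha>"
          using HK[OF t, of v] HK[OF t, of "- v"] \<delta>(2) by auto
      qed (use \<alpha> C \<delta> in auto)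
      moreover have "norm (integral {\<delta>..N} ?\<Phi>) < e / 4"
        using elim(1) t by (simp add: dist_norm)
      moreover have "norm ((2 * Si (R * N) / pi - 1) *\<^sub>R F t) < e / 4"
      proof -
        have "norm ((2 * Si (R * N) / pi - 1) *\<^sub>R F t) \<le> \<bar>2 * Si (R * N) / pi - 1\<bar> * M"
          unfolding norm_scaleR using M(2)[OF t] by (intro mult_left_mono) auto
        also have "\<dots> < e / 4" using elim(2) M(1) by (simp add: dist_real_def abs_mult)
        finally show ?thesis .
      qed
      ultimately have "norm (?J - F t) < e / 4 + e / 4 + e / 4 + e / 4"
        by (smt (verit) norm_triangle_ineq)
      then show "dist ?J (F t) < e" by (simp add: dist_norm)
    qed
  qed
qed

theorem proposition2p6:
  fixes F :: "real \<Rightarrow> 'a::complex_banach"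
  assumes "locally_Holder F"
    and "Bochner_integrable lebesgue F"
    and "\<And>a b :: real. a \<le> b \<Longrightarrow>
      \<exists>\<delta> > 0. \<exists>g :: real \<Rightarrow> real. integrable lebesgue g \<and>
        (\<forall>s. \<bar>s\<bar> \<ge> \<delta> \<longrightarrow> inverse \<bar>s\<bar> * (SUP t\<in>{a..b}. norm (F (t + s))) \<le> g s)"
  shows "\<forall>K. compact K \<longrightarrow>
    uniform_limit K
      (\<lambda>R t. (1 / (2 * pi)) *\<^sub>R
        Bochner_integral (lebesgue_on {-R..R}) (\<lambda>s. exp (\<i> * of_real s * of_real t) *\<^sub>C fourier F s))
      F at_top"
proof (intro allI impI)
  fix K :: "real set" assume K: "compact K"
  have cont: "continuous_on UNIV F"
    using assms(1) by (rule continuous_on_if_locally_Holder)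
  have int: "(\<lambda>x. norm (F x)) integrable_on UNIV"
    using integrable_norm_if_Bochner_integrable[OF assms(2)] by (rule integrable_on_lebesgue)
  show "uniform_limit K (\<lambda>R t. (1 / (2 * pi)) *\<^sub>R
        Bochner_integral (lebesgue_on {-R..R}) (\<lambda>s. exp (\<i> * of_real s * of_real t) *\<^sub>C fourier F s)) F at_top"
  proof (rule uniform_limit_cong[THEN iffD1, OF _ _ dirichlet_integral_tendsto_uniformly[OF assms(1) int K]])
    show "\<forall>\<^sub>F R in at_top. \<forall>t\<in>K. integral UNIV (\<lambda>u. dirichlet_kernel R (t - u) *\<^sub>R F u) =
        (1 / (2 * pi)) *\<^sub>R Bochner_integral (lebesgue_on {-R..R})
          (\<lambda>s. exp (\<i> * of_real s * of_real t) *\<^sub>C fourier F s)"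
      using eventually_ge_at_top[of 0] by eventually_elim (simp add: partial_fourier_inversion[OF cont int])
  qed simp
qed

end
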